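(* Let $(A,\succ,\prec)$ be an anti-dendriform algebra, $E$ a vector space containing $A$ as a subspace and $V$ a complement of $A$ in $E$. (a) Denote $H^2_p(V,A)=\mathcal{A}(A,V)/\equiv$. The map $\Phi:H^2_p(V,A)\to EXT(E,A)$, $\overline{\Omega(A,V)}\mapsto\overline{A\natural V}$, is a bijection, where $\overline{\Omega(A,V)}$ and $\overline{A\natural V}$ are the equivalence classes of $\Omega(A,V)$ and $A\natural V$ under $\equiv$, respectively. (b) Denote $H^2(V,A)=\mathcal{A}(A,V)/\approx$. The map $\Psi:H^2(V,A)\to EXT'(E,A)$, $[\Omega(A,V)]\mapsto[A\natural V]$, is a bijection, where $[\Omega(A,V)]$ and $[A\natural V]$ are the equivalence classes of $\Omega(A,V)$ and $A\natural V$ under $\approx$, respectively.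
   Context: All vector spaces and algebras are over a field $k$, and all algebras are finite-dimensional. An anti-dendriform algebra $(A,\succ,\prec)$ is a vector space with two bilinear maps $\succ,\prec:A\times A\to A$ such that, writing $x\cdot y=x\succ y+x\prec y$, for all $x,y,z$: $x\succ(y\succ z)=-(x\cdot y)\succ z=-x\prec(y\cdot z)=(x\prec y)\prec z$ and $(x\succ y)\prec z=x\succ(y\prec z)$. Homomorphisms preserve both operations. An extending datum of $A$ through $V$ is a system $\Omega(A,V)=(l_{\succ},r_{\succ},l_{\prec},r_{\prec},\rho_{\succ},\mu_{\succ},\rho_{\prec},\mu_{\prec},\varpi_1,\varpi_2,\succ_V,\prec_V)$ of linear maps $l_{\succ},r_{\succ},l_{\prec},r_{\prec}:A\to \mathrm{End}(V)$, $\rho_{\succ},\mu_{\succ},\rho_{\prec},\mu_{\prec}:V\to \mathrm{End}(A)$ and bilinear maps $\varpi_1,\varpi_2:V\times V\to A$, $\succ_V,\prec_V:V\times V\to V$. $A\natural V$ is $A\oplus V$ with $$(x,a)\succeq(y,b)=(x\succ y+\rho_{\succ}(a)y+\mu_{\succ}(b)x+\varpi_1(a,b),\ l_{\succ}(x)b+r_{\succ}(y)a+a\succ_V b),$$ $$(x,a)\preceq(y,b)=(x\prec y+\rho_{\prec}(a)y+\mu_{\prec}(b)x+\varpi_2(a,b),\ l_{\prec}(x)b+r_{\prec}(y)a+a\prec_V b).$$ $\Omega(A,V)$ is an extending structure, and $A\natural V$ a unified product, if this is an anti-dendriform algebra. $\mathcal{A}(A,V)$ is the set of all extending structures of $A$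 through $V$. Through the linear isomorphism $A\oplus V\to E$, $(x,a)\mapsto x+a$, a unified product $A\natural V$ is viewed as an anti-dendriform algebra structure on $E$. Two extending structures $\Omega(A,V)$ and $\Omega'(A,V)$ (the components of the latter carrying primes) are equivalent, $\Omega(A,V)\equiv\Omega'(A,V)$, if there are linear maps $\zeta:V\to A$ and a bijective $\eta:V\to V$ such that for all $x\in A$, $a,b\in V$: $\eta(l_{\succ}(x)a)=l'_{\succ}(x)\eta(a)$, $\eta(r_{\succ}(x)a)=r'_{\succ}(x)\eta(a)$, $\eta(l_{\prec}(x)a)=l'_{\prec}(x)\eta(a)$, $\eta(r_{\prec}(x)a)=r'_{\prec}(x)\eta(a)$; $\zeta(l_{\succ}(x)a)=x\succ\zeta(a)-\mu_{\succ}(a)x+\mu'_{\succ}(\eta(a))x$; $\zeta(r_{\succ}(x)a)=\zeta(a)\succ x-\rho_{\succ}(a)x+\rho'_{\succ}(\eta(a))x$; $\zeta(l_{\prec}(x)a)=x\prec\zeta(a)-\mu_{\prec}(a)x+\mu'_{\prec}(\eta(a))x$; $\zeta(r_{\prec}(x)a)=\zeta(a)\prec x-\rho_{\prec}(a)x+\rho'_{\prec}(\eta(a))x$; $\eta(a\succ_V b)=\eta(a)\succ'_V\eta(b)+l'_{\succ}(\zeta(a))\eta(b)+r'_{\succ}(\zeta(b))\eta(a)$; $\zeta(a\succ_V b)+\varpi_1(a,b)=\zeta(a)\succ\zeta(b)+\rho'_{\succ}(\eta(a))\zeta(b)+\mu'_{\succ}(\eta(b))\zeta(a)+\varpi'_1(\eta(a),\eta(b))$;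 $\eta(a\prec_V b)=\eta(a)\prec'_V\eta(b)+l'_{\prec}(\zeta(a))\eta(b)+r'_{\prec}(\zeta(b))\eta(a)$; $\zeta(a\prec_V b)+\varpi_2(a,b)=\zeta(a)\prec\zeta(b)+\rho'_{\prec}(\eta(a))\zeta(b)+\mu'_{\prec}(\eta(b))\zeta(a)+\varpi'_2(\eta(a),\eta(b))$. If moreover one can take $\eta=\mathrm{id}_V$, they are cohomologous, $\Omega(A,V)\approx\Omega'(A,V)$. Consider all anti-dendriform algebra structures $(\succeq,\preceq)$ on $E$ such that $A$ is an anti-dendriform subalgebra of $E$. Two such structures are equivalent ($\equiv$) if there is an isomorphism of anti-dendriform algebras $\varphi:(E,\succeq,\preceq)\to(E,\succeq',\preceq')$ which stabilizes $A$, i.e. $\varphi|_A=\mathrm{id}_A$; they are cohomologous ($\approx$) if there is such a $\varphi$ which in addition co-stabilizes $V$, i.e. $\pi\varphi=\pi$, where $\pi:E\to V$ is the projection along $A$. $EXT(E,A)$ and $EXT'(E,A)$ denote the sets of equivalence classes of such structures under $\equiv$ and $\approx$ respectively. *)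

theory Defs
  imports "HOL-Analysis.Product_Vector" "HOL-Library.FuncSet"
begin

section \<open>Linear and bilinear maps between subspaces\<close>

text \<open>
  Algebras and complements live on subspaces of an ambient vector space, so (bi)linearity is
  relativised to carrier sets; values outside the carriers are unconstrained.
\<close>

definition linear_on ::
  "('k \<Rightarrow> 'e::ab_group_add \<Rightarrow> 'e) \<Rightarrow> 'e set \<Rightarrow> 'e set \<Rightarrow> ('e \<Rightarrow> 'e) \<Rightarrow> bool"
where
  "linear_on s X Y f \<longleftrightarrow>
     f \<in> X \<rightarrow> Y \<and>
     (\<forall>x\<in>X. \<forall>x'\<in>X. f (x + x') = f x + f x') \<and>
     (\<forall>c. \<forall>x\<in>X. f (s c x) = s c (f x))"

definition bilinear_on ::
  "('k \<Rightarrow> 'e::ab_group_add \<Rightarrow> 'e) \<Rightarrow> 'e set \<Rightarrow> 'e set \<Rightarrow> 'e set \<Rightarrow> ('e \<Rightarrow> 'e \<Rightarrow> 'e) \<Rightarrow> bool"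
where
  "bilinear_on s X Y Z f \<longleftrightarrow>
     (\<forall>x\<in>X. linear_on s Y Z (f x)) \<and> (\<forall>y\<in>Y. linear_on s X Z (\<lambda>x. f x y))"

text \<open>
  Bilinear maps as objects: fixing the value \<^term>\<open>undefined\<close> outside the carriers makes equality of
  functions coincide with equality of maps. A linear map \<open>X \<rightarrow> End(Y)\<close> is an
  element of \<open>bilinear_maps s X Y Y\<close>.
\<close>

definition bilinear_maps ::
  "('k \<Rightarrow> 'e::ab_group_add \<Rightarrow> 'e) \<Rightarrow> 'e set \<Rightarrow> 'e set \<Rightarrow> 'e set \<Rightarrow> ('e \<Rightarrow> 'e \<Rightarrow> 'e) set"
where
  "bilinear_maps s X Y Z = {f \<in> X \<rightarrow>\<^sub>E (Y \<rightarrow>\<^sub>E Z). bilinear_on s X Y Z f}"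


section \<open>Anti-dendriform algebras\<close>

locale anti_dendriform_algebra = vector_space scale
  for scale :: "'k::field \<Rightarrow> 'e::ab_group_add \<Rightarrow> 'e" +
  fixes S :: "'e set"
    and succ :: "'e \<Rightarrow> 'e \<Rightarrow> 'e" (infixl "\<succ>" 70)
    and prec :: "'e \<Rightarrow> 'e \<Rightarrow> 'e" (infixl "\<prec>" 70)
  assumes subspace_carrier: "subspace S"
    and bilinear_succ: "bilinear_on scale S S S (\<succ>)"
    and bilinear_prec: "bilinear_on scale S S S (\<prec>)"
    and anti_dendriform1: "\<lbrakk>x \<in> S; y \<in> S; z \<in> S\<rbrakk> \<Longrightarrow> x \<succ> (y \<succ> z) = - ((x \<succ> y + x \<prec> y) \<succ> z)"
    and anti_dendriform2: "\<lbrakk>x \<in> S; y \<in> S; z \<in> S\<rbrakk> \<Longrightarrow> x \<succ> (y \<succ> z) = - (x \<prec> (y \<succ> z + y \<prec> z))"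
    and anti_dendriform3: "\<lbrakk>x \<in> S; y \<in> S; z \<in> S\<rbrakk> \<Longrightarrow> x \<succ> (y \<succ> z) = (x \<prec> y) \<prec> z"
    and anti_dendriform4: "\<lbrakk>x \<in> S; y \<in> S; z \<in> S\<rbrakk> \<Longrightarrow> (x \<succ> y) \<prec> z = x \<succ> (y \<prec> z)"


section \<open>Extending structures and unified products\<close>

record 'e ext_datum =
  l_succ :: "'e \<Rightarrow> 'e \<Rightarrow> 'e"
  r_succ :: "'e \<Rightarrow> 'e \<Rightarrow> 'e"
  l_prec :: "'e \<Rightarrow> 'e \<Rightarrow> 'e"
  r_prec :: "'e \<Rightarrow> 'e \<Rightarrow> 'e"
  rho_succ :: "'e \<Rightarrow> 'e \<Rightarrow> 'e"
  mu_succ :: "'e \<Rightarrow> 'e \<Rightarrow> 'e"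
  rho_prec :: "'e \<Rightarrow> 'e \<Rightarrow> 'e"
  mu_prec :: "'e \<Rightarrow> 'e \<Rightarrow> 'e"
  varpi1 :: "'e \<Rightarrow> 'e \<Rightarrow> 'e"
  varpi2 :: "'e \<Rightarrow> 'e \<Rightarrow> 'e"
  succ_V :: "'e \<Rightarrow> 'e \<Rightarrow> 'e"
  prec_V :: "'e \<Rightarrow> 'e \<Rightarrow> 'e"

definition extending_datum ::
  "('k \<Rightarrow> 'e::ab_group_add \<Rightarrow> 'e) \<Rightarrow> 'e set \<Rightarrow> 'e set \<Rightarrow> 'e ext_datum \<Rightarrow> bool"
where
  "extending_datum s A V \<Omega> \<longleftrightarrow>
     {l_succ \<Omega>, r_succ \<Omega>, l_prec \<Omega>, r_prec \<Omega>} \<subseteq> bilinear_maps s A V V \<and>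
     {rho_succ \<Omega>, mu_succ \<Omega>, rho_prec \<Omega>, mu_prec \<Omega>} \<subseteq> bilinear_maps s V A A \<and>
     {varpi1 \<Omega>, varpi2 \<Omega>} \<subseteq> bilinear_maps s V V A \<and>
     {succ_V \<Omega>, prec_V \<Omega>} \<subseteq> bilinear_maps s V V V"

text \<open>The operations of \<open>A \<natural> V\<close>, on the external direct sum \<open>A \<times> V\<close>.\<close>

definition unified_succ ::
  "('e \<Rightarrow> 'e \<Rightarrow> 'e) \<Rightarrow> 'e ext_datum \<Rightarrow> 'e \<times> 'e \<Rightarrow> 'e \<times> 'e \<Rightarrow> 'e::ab_group_add \<times> 'e"
where
  "unified_succ succ \<Omega> = (\<lambda>(x, a) (y, b).
     (succ x y + rho_succ \<Omega> a y + mu_succ \<Omega> b x + varpi1 \<Omega> a b,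
      l_succ \<Omega> x b + r_succ \<Omega> y a + succ_V \<Omega> a b))"

definition unified_prec ::
  "('e \<Rightarrow> 'e \<Rightarrow> 'e) \<Rightarrow> 'e ext_datum \<Rightarrow> 'e \<times> 'e \<Rightarrow> 'e \<times> 'e \<Rightarrow> 'e::ab_group_add \<times> 'e"
where
  "unified_prec prec \<Omega> = (\<lambda>(x, a) (y, b).
     (prec x y + rho_prec \<Omega> a y + mu_prec \<Omega> b x + varpi2 \<Omega> a b,
      l_prec \<Omega> x b + r_prec \<Omega> y a + prec_V \<Omega> a b))"

definition extending_structures ::
  "('k::field \<Rightarrow> 'e::ab_group_add \<Rightarrow> 'e) \<Rightarrow> 'e set \<Rightarrow> 'e set \<Rightarrow>
   ('e \<Rightarrow> 'e \<Rightarrow> 'e) \<Rightarrow> ('e \<Rightarrow> 'e \<Rightarrow> 'e) \<Rightarrow> 'e ext_datum set"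
where
  "extending_structures s A V succ prec =
     {\<Omega>. extending_datum s A V \<Omega> \<and>
          anti_dendriform_algebra (module_prod.scale s s) (A \<times> V)
            (unified_succ succ \<Omega>) (unified_prec prec \<Omega>)}"

text \<open>
  For complementary \<open>A\<close> and \<open>V\<close>, the inverse of the isomorphism
  \<open>A \<times> V \<rightarrow> E\<close>, \<open>(x, a) \<mapsto> x + a\<close>, and the projection of \<open>E\<close> onto \<open>V\<close> along \<open>A\<close>.
\<close>

definition decomp :: "'e::ab_group_add set \<Rightarrow> 'e set \<Rightarrow> 'e \<Rightarrow> 'e \<times> 'e" where
  "decomp A V = inv_into (A \<times> V) (\<lambda>(x, a). x + a)"

definition proj_along :: "'e::ab_group_add set \<Rightarrow> 'e set \<Rightarrow> 'e \<Rightarrow> 'e" where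
  "proj_along A V e = snd (decomp A V e)"

text \<open>The pair of operations of \<open>A \<natural> V\<close>, transported to \<open>E\<close> along \<open>(x, a) \<mapsto> x + a\<close>.\<close>

definition unified_product ::
  "'e::ab_group_add set \<Rightarrow> 'e set \<Rightarrow> ('e \<Rightarrow> 'e \<Rightarrow> 'e) \<Rightarrow> ('e \<Rightarrow> 'e \<Rightarrow> 'e) \<Rightarrow> 'e ext_datum \<Rightarrow>
   ('e \<Rightarrow> 'e \<Rightarrow> 'e) \<times> ('e \<Rightarrow> 'e \<Rightarrow> 'e)"
where
  "unified_product A V succ prec \<Omega> =
     ((\<lambda>u v. case unified_succ succ \<Omega> (decomp A V u) (decomp A V v) of (x, a) \<Rightarrow> x + a),
      (\<lambda>u v. case unified_prec prec \<Omega> (decomp A V u) (decomp A V v) of (x, a) \<Rightarrow> x + a))"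


section \<open>Equivalence of extending structures\<close>

text \<open>The compatibility conditions on \<open>\<zeta> : V \<rightarrow> A\<close> and \<open>\<eta> : V \<rightarrow> V\<close>.\<close>

definition datum_morphism ::
  "('k \<Rightarrow> 'e::ab_group_add \<Rightarrow> 'e) \<Rightarrow> 'e set \<Rightarrow> 'e set \<Rightarrow>
   ('e \<Rightarrow> 'e \<Rightarrow> 'e) \<Rightarrow> ('e \<Rightarrow> 'e \<Rightarrow> 'e) \<Rightarrow> 'e ext_datum \<Rightarrow> 'e ext_datum \<Rightarrow>
   ('e \<Rightarrow> 'e) \<Rightarrow> ('e \<Rightarrow> 'e) \<Rightarrow> bool"
where
  "datum_morphism s A V succ prec \<Omega> \<Omega>' \<zeta> \<eta> \<longleftrightarrow>
     linear_on s V A \<zeta> \<and> linear_on s V V \<eta> \<and> bij_betw \<eta> V V \<and>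
     (\<forall>x\<in>A. \<forall>a\<in>V.
        \<eta> (l_succ \<Omega> x a) = l_succ \<Omega>' x (\<eta> a) \<and>
        \<eta> (r_succ \<Omega> x a) = r_succ \<Omega>' x (\<eta> a) \<and>
        \<eta> (l_prec \<Omega> x a) = l_prec \<Omega>' x (\<eta> a) \<and>
        \<eta> (r_prec \<Omega> x a) = r_prec \<Omega>' x (\<eta> a) \<and>
        \<zeta> (l_succ \<Omega> x a) = succ x (\<zeta> a) - mu_succ \<Omega> a x + mu_succ \<Omega>' (\<eta> a) x \<and>
        \<zeta> (r_succ \<Omega> x a) = succ (\<zeta> a) x - rho_succ \<Omega> a x + rho_succ \<Omega>' (\<eta> a) x \<and>
        \<zeta> (l_prec \<Omega> x a) = prec x (\<zeta> a) - mu_prec \<Omega> a x + mu_prec \<Omega>' (\<eta> a) x \<and>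
        \<zeta> (r_prec \<Omega> x a) = prec (\<zeta> a) x - rho_prec \<Omega> a x + rho_prec \<Omega>' (\<eta> a) x) \<and>
     (\<forall>a\<in>V. \<forall>b\<in>V.
        \<eta> (succ_V \<Omega> a b) =
          succ_V \<Omega>' (\<eta> a) (\<eta> b) + l_succ \<Omega>' (\<zeta> a) (\<eta> b) + r_succ \<Omega>' (\<zeta> b) (\<eta> a) \<and>
        \<zeta> (succ_V \<Omega> a b) + varpi1 \<Omega> a b =
          succ (\<zeta> a) (\<zeta> b) + rho_succ \<Omega>' (\<eta> a) (\<zeta> b) + mu_succ \<Omega>' (\<eta> b) (\<zeta> a)
            + varpi1 \<Omega>' (\<eta> a) (\<eta> b) \<and>
        \<eta> (prec_V \<Omega> a b) =
          prec_V \<Omega>' (\<eta> a) (\<eta> b) + l_prec \<Omega>' (\<zeta> a) (\<eta> b) + r_prec \<Omega>' (\<zeta> b) (\<eta> a) \<and>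
        \<zeta> (prec_V \<Omega> a b) + varpi2 \<Omega> a b =
          prec (\<zeta> a) (\<zeta> b) + rho_prec \<Omega>' (\<eta> a) (\<zeta> b) + mu_prec \<Omega>' (\<eta> b) (\<zeta> a)
            + varpi2 \<Omega>' (\<eta> a) (\<eta> b))"

definition datum_equiv ::
  "('k::field \<Rightarrow> 'e::ab_group_add \<Rightarrow> 'e) \<Rightarrow> 'e set \<Rightarrow> 'e set \<Rightarrow>
   ('e \<Rightarrow> 'e \<Rightarrow> 'e) \<Rightarrow> ('e \<Rightarrow> 'e \<Rightarrow> 'e) \<Rightarrow> ('e ext_datum \<times> 'e ext_datum) set"
where
  "datum_equiv s A V succ prec =
     {(\<Omega>, \<Omega>'). \<Omega> \<in> extending_structures s A V succ prec \<and>
               \<Omega>' \<in> extending_structures s A V succ prec \<and>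
               (\<exists>\<zeta> \<eta>. datum_morphism s A V succ prec \<Omega> \<Omega>' \<zeta> \<eta>)}"

definition datum_cohom ::
  "('k::field \<Rightarrow> 'e::ab_group_add \<Rightarrow> 'e) \<Rightarrow> 'e set \<Rightarrow> 'e set \<Rightarrow>
   ('e \<Rightarrow> 'e \<Rightarrow> 'e) \<Rightarrow> ('e \<Rightarrow> 'e \<Rightarrow> 'e) \<Rightarrow> ('e ext_datum \<times> 'e ext_datum) set"
where
  "datum_cohom s A V succ prec =
     {(\<Omega>, \<Omega>'). \<Omega> \<in> extending_structures s A V succ prec \<and>
               \<Omega>' \<in> extending_structures s A V succ prec \<and>
               (\<exists>\<zeta> \<eta>. datum_morphism s A V succ prec \<Omega> \<Omega>' \<zeta> \<eta> \<and> (\<forall>a\<in>V. \<eta> a = a))}"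

definition H2p ::
  "('k::field \<Rightarrow> 'e::ab_group_add \<Rightarrow> 'e) \<Rightarrow> 'e set \<Rightarrow> 'e set \<Rightarrow>
   ('e \<Rightarrow> 'e \<Rightarrow> 'e) \<Rightarrow> ('e \<Rightarrow> 'e \<Rightarrow> 'e) \<Rightarrow> 'e ext_datum set set"
where
  "H2p s A V succ prec = extending_structures s A V succ prec // datum_equiv s A V succ prec"

definition H2 ::
  "('k::field \<Rightarrow> 'e::ab_group_add \<Rightarrow> 'e) \<Rightarrow> 'e set \<Rightarrow> 'e set \<Rightarrow>
   ('e \<Rightarrow> 'e \<Rightarrow> 'e) \<Rightarrow> ('e \<Rightarrow> 'e \<Rightarrow> 'e) \<Rightarrow> 'e ext_datum set set"
where
  "H2 s A V succ prec = extending_structures s A V succ prec // datum_cohom s A V succ prec"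


section \<open>Anti-dendriform structures on the ambient space\<close>

text \<open>Here \<open>E\<close> is the whole type \<^typ>\<open>'e\<close>.\<close>

definition extension_structures ::
  "('k::field \<Rightarrow> 'e::ab_group_add \<Rightarrow> 'e) \<Rightarrow> 'e set \<Rightarrow> ('e \<Rightarrow> 'e \<Rightarrow> 'e) \<Rightarrow> ('e \<Rightarrow> 'e \<Rightarrow> 'e) \<Rightarrow>
   (('e \<Rightarrow> 'e \<Rightarrow> 'e) \<times> ('e \<Rightarrow> 'e \<Rightarrow> 'e)) set"
where
  "extension_structures s A succ prec =
     {(f, g). anti_dendriform_algebra s UNIV f g \<and>
              (\<forall>x\<in>A. \<forall>y\<in>A. f x y = succ x y \<and> g x y = prec x y)}"

definition algebra_iso ::
  "('k::field \<Rightarrow> 'e::ab_group_add \<Rightarrow> 'e) \<Rightarrow> ('e \<Rightarrow> 'e \<Rightarrow> 'e) \<times> ('e \<Rightarrow> 'e \<Rightarrow> 'e) \<Rightarrow>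
   ('e \<Rightarrow> 'e \<Rightarrow> 'e) \<times> ('e \<Rightarrow> 'e \<Rightarrow> 'e) \<Rightarrow> ('e \<Rightarrow> 'e) \<Rightarrow> bool"
where
  "algebra_iso s P Q \<phi> \<longleftrightarrow>
     Vector_Spaces.linear s s \<phi> \<and> bij \<phi> \<and>
     (\<forall>u v. \<phi> (fst P u v) = fst Q (\<phi> u) (\<phi> v)) \<and>
     (\<forall>u v. \<phi> (snd P u v) = snd Q (\<phi> u) (\<phi> v))"

definition extension_equiv ::
  "('k::field \<Rightarrow> 'e::ab_group_add \<Rightarrow> 'e) \<Rightarrow> 'e set \<Rightarrow> ('e \<Rightarrow> 'e \<Rightarrow> 'e) \<Rightarrow> ('e \<Rightarrow> 'e \<Rightarrow> 'e) \<Rightarrow>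
   ((('e \<Rightarrow> 'e \<Rightarrow> 'e) \<times> ('e \<Rightarrow> 'e \<Rightarrow> 'e)) \<times> (('e \<Rightarrow> 'e \<Rightarrow> 'e) \<times> ('e \<Rightarrow> 'e \<Rightarrow> 'e))) set"
where
  "extension_equiv s A succ prec =
     {(P, Q). P \<in> extension_structures s A succ prec \<and> Q \<in> extension_structures s A succ prec \<and>
              (\<exists>\<phi>. algebra_iso s P Q \<phi> \<and> (\<forall>x\<in>A. \<phi> x = x))}"

definition extension_cohom ::
  "('k::field \<Rightarrow> 'e::ab_group_add \<Rightarrow> 'e) \<Rightarrow> 'e set \<Rightarrow> 'e set \<Rightarrow>
   ('e \<Rightarrow> 'e \<Rightarrow> 'e) \<Rightarrow> ('e \<Rightarrow> 'e \<Rightarrow> 'e) \<Rightarrow>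
   ((('e \<Rightarrow> 'e \<Rightarrow> 'e) \<times> ('e \<Rightarrow> 'e \<Rightarrow> 'e)) \<times> (('e \<Rightarrow> 'e \<Rightarrow> 'e) \<times> ('e \<Rightarrow> 'e \<Rightarrow> 'e))) set"
where
  "extension_cohom s A V succ prec =
     {(P, Q). P \<in> extension_structures s A succ prec \<and> Q \<in> extension_structures s A succ prec \<and>
              (\<exists>\<phi>. algebra_iso s P Q \<phi> \<and> (\<forall>x\<in>A. \<phi> x = x) \<and>
                   proj_along A V \<circ> \<phi> = proj_along A V)}"

definition EXT ::
  "('k::field \<Rightarrow> 'e::ab_group_add \<Rightarrow> 'e) \<Rightarrow> 'e set \<Rightarrow> ('e \<Rightarrow> 'e \<Rightarrow> 'e) \<Rightarrow> ('e \<Rightarrow> 'e \<Rightarrow> 'e) \<Rightarrow>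
   (('e \<Rightarrow> 'e \<Rightarrow> 'e) \<times> ('e \<Rightarrow> 'e \<Rightarrow> 'e)) set set"
where
  "EXT s A succ prec = extension_structures s A succ prec // extension_equiv s A succ prec"

definition EXT' ::
  "('k::field \<Rightarrow> 'e::ab_group_add \<Rightarrow> 'e) \<Rightarrow> 'e set \<Rightarrow> 'e set \<Rightarrow>
   ('e \<Rightarrow> 'e \<Rightarrow> 'e) \<Rightarrow> ('e \<Rightarrow> 'e \<Rightarrow> 'e) \<Rightarrow> (('e \<Rightarrow> 'e \<Rightarrow> 'e) \<times> ('e \<Rightarrow> 'e \<Rightarrow> 'e)) set set"
where
  "EXT' s A V succ prec = extension_structures s A succ prec // extension_cohom s A V succ prec"

end

theory Submission
  imports Defs
begin

text \<open>
  Both classifications hold before passing to classes: the unified product gives a bijection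
  between the extending structures of \<open>A\<close> through \<open>V\<close> and the anti-dendriform structures on \<open>E\<close>
  that restrict to the given one on \<open>A\<close>. A bilinear operation on \<open>E = A \<oplus> V\<close> is determined by its
  values on \<open>A \<times> A\<close>, \<open>A \<times> V\<close>, \<open>V \<times> A\<close> and \<open>V \<times> V\<close>, each of which splits into an \<open>A\<close>-component and a
  \<open>V\<close>-component. On \<open>A \<times> A\<close> the operation is prescribed and stays in \<open>A\<close>; the remaining six blocks
  per operation are the twelve maps of an extending datum. Reading the blocks off an operation
  inverts the formation of the unified product (\<open>bij_product\<close>), and the anti-dendriform identities
  pass between \<open>A \<times> V\<close> and \<open>E\<close> along the isomorphism \<open>(x, a) \<mapsto> x + a\<close>
  (\<open>anti_dendriform_algebra_transport\<close>).

  Similarly, a linear map of \<open>E\<close> fixing \<open>A\<close> pointwise is the same as a pair of linear maps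
  \<open>\<zeta> : V \<rightarrow> A\<close> and \<open>\<eta> : V \<rightarrow> V\<close>, via \<open>x + a \<mapsto> x + \<zeta> a + \<eta> a\<close>. It is bijective exactly when \<open>\<eta>\<close> is, it
  co-stabilizes \<open>V\<close> exactly when \<open>\<eta>\<close> is the identity, and comparing components block by block turns
  multiplicativity into the compatibility conditions on \<open>(\<zeta>, \<eta>)\<close>
  (\<open>block_map_multiplicative_iff\<close>). So the bijection carries each relation on extending structures
  exactly to the corresponding relation on algebra structures (\<open>equiv_iff\<close>), and taking direct
  images of classes gives the two bijections of quotients (\<open>image_bij_betw_quotients\<close>).
\<close>

section \<open>Quotients along a bijection\<close>

text \<open>
  A bijection that matches two relations carries the sets \<open>R `` {x}\<close> to the sets \<open>S `` {F x}\<close>, so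
  taking images under \<open>F\<close> is a map of quotients that involves no choice of representatives.
\<close>

lemma image_bij_betw_quotients:
  assumes F: "bij_betw F X Y" and R: "R \<subseteq> X \<times> X" and S: "S \<subseteq> Y \<times> Y"
    and rel: "\<And>x x'. x \<in> X \<Longrightarrow> x' \<in> X \<Longrightarrow> (x, x') \<in> R \<longleftrightarrow> (F x, F x') \<in> S"
  shows "(\<forall>x\<in>X. F ` (R `` {x}) = S `` {F x}) \<and> bij_betw ((`) F) (X // R) (Y // S)"
proof
  have img: "F ` X = Y" and inj: "inj_on F X"
    using F by (auto simp: bij_betw_def)
  show cls: "\<forall>x\<in>X. F ` (R `` {x}) = S `` {F x}"
  proof
    fix x assume x: "x \<in> X"
    show "F ` (R `` {x}) = S `` {F x}"
    proof (intro equalityI subsetI)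
      fix y assume "y \<in> F ` (R `` {x})"
      then show "y \<in> S `` {F x}" using R rel x by auto
    next
      fix y assume y: "y \<in> S `` {F x}"
      then obtain x' where "x' \<in> X" "y = F x'" using S img by auto
      then show "y \<in> F ` (R `` {x})" using y rel x by auto
    qed
  qed
  have "inj_on ((`) F) (X // R)"
  proof (rule inj_on_subset[OF inj_on_image_Pow[OF inj]])
    show "X // R \<subseteq> Pow X" using R by (auto simp: quotient_def)
  qed
  moreover have "(`) F ` (X // R) = Y // S"
    unfolding quotient_def img[symmetric] using cls by auto
  ultimately show "bij_betw ((`) F) (X // R) (Y // S)"
    by (simp add: bij_betw_def)
qed

section \<open>Transport of anti-dendriform structures\<close>

text \<open>
  Stated for different ambient types, so that it can be applied to \<open>(x, a) \<mapsto> x + a\<close> as well as to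
  its inverse.
\<close>

lemma anti_dendriform_algebra_transport:
  fixes s :: "'k::field \<Rightarrow> 'd::ab_group_add \<Rightarrow> 'd" and t :: "'k \<Rightarrow> 'e::ab_group_add \<Rightarrow> 'e"
  assumes alg: "anti_dendriform_algebra s S p q"
    and vs: "vector_space t" and T: "module.subspace t T"
    and bij: "bij_betw h S T"
    and add: "\<And>x y. x \<in> S \<Longrightarrow> y \<in> S \<Longrightarrow> h (x + y) = h x + h y"
    and scale: "\<And>c x. x \<in> S \<Longrightarrow> h (s c x) = t c (h x)"
    and p': "\<And>x y. x \<in> S \<Longrightarrow> y \<in> S \<Longrightarrow> p' (h x) (h y) = h (p x y)"
    and q': "\<And>x y. x \<in> S \<Longrightarrow> y \<in> S \<Longrightarrow> q' (h x) (h y) = h (q x y)"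
  shows "anti_dendriform_algebra t T p' q'"
proof -
  interpret D: anti_dendriform_algebra s S p q by (rule alg)
  interpret t: vector_space t by (rule vs)
  have T_eq: "T = h ` S" using bij by (auto simp: bij_betw_def)
  note S = D.subspace_carrier
  have plus: "x + y \<in> S" if "x \<in> S" "y \<in> S" for x y
    using D.subspace_add[OF S] that by blast
  have scl: "s c x \<in> S" if "x \<in> S" for c x
    using D.subspace_scale[OF S] that by blast
  have neg: "h (- x) = - h x" if "x \<in> S" for x
    using scale[OF that, of "-1"] by simp
  have pS: "p x y \<in> S" and qS: "q x y \<in> S" if "x \<in> S" "y \<in> S" for x y
    using D.bilinear_succ D.bilinear_prec that
    by (auto simp: bilinear_on_def linear_on_def)
  have bil: "bilinear_on t T T T r'"
    if "bilinear_on s S S S r" and r': "\<And>x y. x \<in> S \<Longrightarrow> y \<in> S \<Longrightarrow> r' (h x) (h y) = h (r x y)"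
    for r r'
  proof -
    have rS: "r x y \<in> S" if "x \<in> S" "y \<in> S" for x y
      using \<open>bilinear_on s S S S r\<close> that by (auto simp: bilinear_on_def linear_on_def)
    have eqs: "r (x + x') y = r x y + r x' y" "r y (x + x') = r y x + r y x'"
        "r (s c x) y = s c (r x y)" "r y (s c x) = s c (r y x)"
      if "x \<in> S" "x' \<in> S" "y \<in> S" for x x' y c
      using \<open>bilinear_on s S S S r\<close> that by (auto simp: bilinear_on_def linear_on_def)
    have sum: "r' (h x + h x') (h y) = r' (h x) (h y) + r' (h x') (h y)"
        "r' (h y) (h x + h x') = r' (h y) (h x) + r' (h y) (h x')"
        "r' (t c (h x)) (h y) = t c (r' (h x) (h y))"
        "r' (h y) (t c (h x)) = t c (r' (h y) (h x))"
      if "x \<in> S" "x' \<in> S" "y \<in> S" for x x' y c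
      using that by (simp_all flip: add scale add: r' rS eqs plus scl)
    show ?thesis
      unfolding bilinear_on_def linear_on_def T_eq by (auto simp: sum r' rS)
  qed
  show ?thesis
  proof
    show "t.subspace T" by (rule T)
    show "bilinear_on t T T T p'" "bilinear_on t T T T q'"
      using bil[OF D.bilinear_succ] bil[OF D.bilinear_prec] p' q' by blast+
  next
    fix x' y' z' assume "x' \<in> T" "y' \<in> T" "z' \<in> T"
    then obtain x y z where xyz: "x \<in> S" "y \<in> S" "z \<in> S" and eq: "x' = h x" "y' = h y" "z' = h z"
      unfolding T_eq by blast
    note simps = eq p' q' pS qS plus neg[symmetric] add[symmetric] xyz
    show "p' x' (p' y' z') = - p' (p' x' y' + q' x' y') z'"
      using D.anti_dendriform1[OF xyz] by (simp add: simps)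
    show "p' x' (p' y' z') = - q' x' (p' y' z' + q' y' z')"
      using D.anti_dendriform2[OF xyz] by (simp add: simps)
    show "p' x' (p' y' z') = q' (q' x' y') z'"
      using D.anti_dendriform3[OF xyz] by (simp add: simps)
    show "q' (p' x' y') z' = p' x' (q' y' z')"
      using D.anti_dendriform4[OF xyz] by (simp add: simps)
  qed
qed

section \<open>Direct sum decompositions\<close>

locale complementary_subspaces = vector_space scale
  for scale :: "'k::field \<Rightarrow> 'e::ab_group_add \<Rightarrow> 'e" +
  fixes A V :: "'e set"
  assumes A: "subspace A" and V: "subspace V"
    and Int_eq: "A \<inter> V = {0}"
    and sum_eq: "{x + a | x a. x \<in> A \<and> a \<in> V} = UNIV"
begin

abbreviation proj_A :: "'e \<Rightarrow> 'e" where "proj_A u \<equiv> fst (decomp A V u)"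
abbreviation proj_V :: "'e \<Rightarrow> 'e" where "proj_V u \<equiv> snd (decomp A V u)"

lemma zero_mem [simp]: "0 \<in> A" "0 \<in> V"
  using A V by (auto simp: subspace_0)

lemma add_mem [simp]: "x \<in> A \<Longrightarrow> y \<in> A \<Longrightarrow> x + y \<in> A" "a \<in> V \<Longrightarrow> b \<in> V \<Longrightarrow> a + b \<in> V"
  using A V by (auto simp: subspace_add)

lemma scale_mem [simp]: "x \<in> A \<Longrightarrow> scale c x \<in> A" "a \<in> V \<Longrightarrow> scale c a \<in> V"
  using A V by (auto simp: subspace_scale)

lemma sum_cancel:
  assumes "x \<in> A" "a \<in> V" "y \<in> A" "b \<in> V"
  shows "x + a = y + b \<longleftrightarrow> x = y \<and> a = b"
proof
  assume eq: "x + a = y + b"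
  then have "x - y = b - a" by (simp add: algebra_simps)
  moreover have "x - y \<in> A" "b - a \<in> V"
    using assms A V by (auto intro: subspace_diff)
  ultimately have "x - y = 0" using Int_eq by (metis IntI singletonD)
  with eq show "x = y \<and> a = b" by auto
qed auto

lemma bij_betw_sum: "bij_betw (\<lambda>(x, a). x + a) (A \<times> V) UNIV"
  unfolding bij_betw_def
proof
  show "inj_on (\<lambda>(x, a). x + a) (A \<times> V)"
    by (auto simp: inj_on_def sum_cancel)
  show "(\<lambda>(x, a). x + a) ` (A \<times> V) = UNIV"
    using sum_eq by (force simp: set_eq_iff)
qed

lemma decomp_sum [simp]: "x \<in> A \<Longrightarrow> a \<in> V \<Longrightarrow> decomp A V (x + a) = (x, a)"
  unfolding decomp_def
  using inv_into_f_f[OF bij_betw_imp_inj_on[OF bij_betw_sum], of "(x, a)"] by simp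

lemma decomp_A [simp]: "x \<in> A \<Longrightarrow> decomp A V x = (x, 0)"
  using decomp_sum[of x 0] by simp

lemma decomp_V [simp]: "a \<in> V \<Longrightarrow> decomp A V a = (0, a)"
  using decomp_sum[of 0 a] by simp

lemma decompE:
  obtains x a where "x \<in> A" "a \<in> V" "u = x + a"
  using sum_eq by blast

lemma proj_mem [simp]: "proj_A u \<in> A" "proj_V u \<in> V"
  by (rule decompE[of u]; simp)+

lemma proj_sum [simp]: "proj_A u + proj_V u = u"
  by (rule decompE[of u]) simp

lemma decomp_add: "decomp A V (u + v) = decomp A V u + decomp A V v"
proof -
  obtain x a y b where u: "x \<in> A" "a \<in> V" "u = x + a" and v: "y \<in> A" "b \<in> V" "v = y + b"
    by (metis decompE)
  have "u + v = (x + y) + (a + b)" using u v by (simp add: algebra_simps)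
  then have "decomp A V (u + v) = (x + y, a + b)" using u v by (simp only: decomp_sum add_mem)
  then show ?thesis using u v by simp
qed

lemma decomp_scale: "decomp A V (scale c u) = (scale c (proj_A u), scale c (proj_V u))"
proof -
  have "scale c u = scale c (proj_A u) + scale c (proj_V u)"
    by (metis proj_sum scale_right_distrib)
  then show ?thesis by (simp del: proj_sum)
qed

lemma bij_decomp: "bij_betw (decomp A V) UNIV (A \<times> V)"
  unfolding decomp_def by (rule bij_betw_inv_into[OF bij_betw_sum])

lemma eq_iff_proj: "u = v \<longleftrightarrow> proj_A u = proj_A v \<and> proj_V u = proj_V v"
  by (metis proj_sum)

lemma proj_simps:
  "proj_A (u + v) = proj_A u + proj_A v" "proj_V (u + v) = proj_V u + proj_V v"
  "proj_A (scale c u) = scale c (proj_A u)" "proj_V (scale c u) = scale c (proj_V u)"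
  by (simp_all add: decomp_add decomp_scale)

lemma vector_space_prod: "vector_space (module_prod.scale scale scale)"
  by (unfold_locales)
    (auto simp: module_prod.scale_def[OF module_prod.intro] module_pair_def module_axioms algebra_simps)

lemma subspace_prod: "module.subspace (module_prod.scale scale scale) (A \<times> V)"
proof -
  interpret module_prod scale scale ..
  show ?thesis by (rule subspace_Times[OF A V])
qed

section \<open>Block form of a bilinear operation\<close>

text \<open>
  The components of \<open>f\<close> with respect to \<open>E = A \<oplus> V\<close>, with arguments in the order of one half of an
  extending datum; \<open>m\<close> is the operation on \<open>A\<close>. As in an extending datum, \<open>l\<close> and \<open>r\<close> take the element
  of \<open>A\<close> first and \<open>\<rho>\<close> and \<open>\<mu>\<close> take the element of \<open>V\<close> first, whatever the order of the factors in \<open>f\<close>.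
\<close>

definition has_blocks ::
  "('e \<Rightarrow> 'e \<Rightarrow> 'e) \<Rightarrow> ('e \<Rightarrow> 'e \<Rightarrow> 'e) \<Rightarrow> ('e \<Rightarrow> 'e \<Rightarrow> 'e) \<Rightarrow> ('e \<Rightarrow> 'e \<Rightarrow> 'e) \<Rightarrow>
   ('e \<Rightarrow> 'e \<Rightarrow> 'e) \<Rightarrow> ('e \<Rightarrow> 'e \<Rightarrow> 'e) \<Rightarrow> ('e \<Rightarrow> 'e \<Rightarrow> 'e) \<Rightarrow> ('e \<Rightarrow> 'e \<Rightarrow> 'e) \<Rightarrow> bool"
where
  "has_blocks f m l r \<rho> \<mu> w v \<longleftrightarrow>
     (\<forall>x\<in>A. \<forall>y\<in>A. m x y \<in> A \<and> f x y = m x y) \<and>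
     (\<forall>x\<in>A. \<forall>a\<in>V. \<mu> a x \<in> A \<and> l x a \<in> V \<and> f x a = \<mu> a x + l x a) \<and>
     (\<forall>x\<in>A. \<forall>a\<in>V. \<rho> a x \<in> A \<and> r x a \<in> V \<and> f a x = \<rho> a x + r x a) \<and>
     (\<forall>a\<in>V. \<forall>b\<in>V. w a b \<in> A \<and> v a b \<in> V \<and> f a b = w a b + v a b)"

definition biadditive :: "('e \<Rightarrow> 'e \<Rightarrow> 'e) \<Rightarrow> bool" where
  "biadditive f \<longleftrightarrow> (\<forall>u u' v. f (u + u') v = f u v + f u' v \<and> f v (u + u') = f v u + f v u')"

lemma biadditive_if_bilinear_on: "bilinear_on scale UNIV UNIV UNIV f \<Longrightarrow> biadditive f"
  by (auto simp: biadditive_def bilinear_on_def linear_on_def)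

lemma linear_on_zero: "linear_on scale X Y h \<Longrightarrow> 0 \<in> X \<Longrightarrow> h 0 = 0"
  unfolding linear_on_def by (metis scale_zero_left)

lemma bilinear_on_zero:
  assumes "bilinear_on scale X Y Z f"
  shows "0 \<in> X \<Longrightarrow> y \<in> Y \<Longrightarrow> f 0 y = 0" and "x \<in> X \<Longrightarrow> 0 \<in> Y \<Longrightarrow> f x 0 = 0"
  using assms linear_on_zero[of X Z "\<lambda>x. f x y"] linear_on_zero[of Y Z "f x"]
  by (auto simp: bilinear_on_def)

lemma decomp_op_if_has_blocks:
  assumes "biadditive f" "has_blocks f m l r \<rho> \<mu> w v" "x \<in> A" "a \<in> V" "y \<in> A" "b \<in> V"
  shows "decomp A V (f (x + a) (y + b)) =
    (m x y + \<rho> a y + \<mu> b x + w a b, l x b + r y a + v a b)"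
proof -
  have "f (x + a) (y + b) = f x y + f x b + f a y + f a b"
    using assms(1) by (simp add: biadditive_def algebra_simps)
  also have "\<dots> = (m x y + \<rho> a y + \<mu> b x + w a b) + (l x b + r y a + v a b)"
    using assms(2-) by (simp add: has_blocks_def algebra_simps)
  finally show ?thesis
    using assms(2-) by (simp add: has_blocks_def del: add.assoc)
qed

text \<open>
  Restricting to the carriers makes the blocks extensional, hence admissible as components of an
  extending datum.
\<close>

lemma has_blocks_read_off:
  assumes "\<And>x y. x \<in> A \<Longrightarrow> y \<in> A \<Longrightarrow> f x y = m x y \<and> m x y \<in> A"
  shows "has_blocks f m
    (\<lambda>x\<in>A. \<lambda>a\<in>V. proj_V (f x a)) (\<lambda>x\<in>A. \<lambda>a\<in>V. proj_V (f a x))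
    (\<lambda>a\<in>V. \<lambda>x\<in>A. proj_A (f a x)) (\<lambda>a\<in>V. \<lambda>x\<in>A. proj_A (f x a))
    (\<lambda>a\<in>V. \<lambda>b\<in>V. proj_A (f a b)) (\<lambda>a\<in>V. \<lambda>b\<in>V. proj_V (f a b))"
  using assms by (simp add: has_blocks_def)

lemma bilinear_read_off:
  assumes f: "bilinear_on scale UNIV UNIV UNIV f"
    and X: "X = A \<or> X = V" and Y: "Y = A \<or> Y = V"
  shows "(\<lambda>x\<in>X. \<lambda>y\<in>Y. proj_A (f x y)) \<in> bilinear_maps scale X Y A"
    and "(\<lambda>x\<in>X. \<lambda>y\<in>Y. proj_V (f x y)) \<in> bilinear_maps scale X Y V"
    and "(\<lambda>x\<in>X. \<lambda>y\<in>Y. proj_A (f y x)) \<in> bilinear_maps scale X Y A"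
    and "(\<lambda>x\<in>X. \<lambda>y\<in>Y. proj_V (f y x)) \<in> bilinear_maps scale X Y V"
proof -
  have f': "f (u + u') v = f u v + f u' v" "f v (u + u') = f v u + f v u'"
    "f (scale c u) v = scale c (f u v)" "f v (scale c u) = scale c (f v u)" for u u' v c
    using f by (auto simp: bilinear_on_def linear_on_def)
  have X': "x + x' \<in> X" "scale c x \<in> X" if "x \<in> X" "x' \<in> X" for x x' c using X that by auto
  have Y': "x + x' \<in> Y" "scale c x \<in> Y" if "x \<in> Y" "x' \<in> Y" for x x' c using Y that by auto
  show "(\<lambda>x\<in>X. \<lambda>y\<in>Y. proj_A (f x y)) \<in> bilinear_maps scale X Y A"
    "(\<lambda>x\<in>X. \<lambda>y\<in>Y. proj_V (f x y)) \<in> bilinear_maps scale X Y V"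
    "(\<lambda>x\<in>X. \<lambda>y\<in>Y. proj_A (f y x)) \<in> bilinear_maps scale X Y A"
    "(\<lambda>x\<in>X. \<lambda>y\<in>Y. proj_V (f y x)) \<in> bilinear_maps scale X Y V"
    by (auto simp: bilinear_maps_def bilinear_on_def linear_on_def f' proj_simps X' Y')
qed

text \<open>
  The sum of \<open>A\<close> and \<open>V\<close> being direct determines the blocks on the carriers; elements of
  \<open>bilinear_maps\<close> have no freedom elsewhere.
\<close>

lemma has_blocks_unique:
  assumes 1: "has_blocks f m l r \<rho> \<mu> w v" and 2: "has_blocks f m l' r' \<rho>' \<mu>' w' v'"
    and "{l, r, l', r'} \<subseteq> bilinear_maps scale A V V" "{\<rho>, \<mu>, \<rho>', \<mu>'} \<subseteq> bilinear_maps scale V A A"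
    "{w, w'} \<subseteq> bilinear_maps scale V V A" "{v, v'} \<subseteq> bilinear_maps scale V V V"
  shows "l = l'" "r = r'" "\<rho> = \<rho>'" "\<mu> = \<mu>'" "w = w'" "v = v'"
proof -
  have ext: "g = g'" if "g \<in> bilinear_maps scale X Y Z" "g' \<in> bilinear_maps scale X Y Z"
    "\<And>x y. x \<in> X \<Longrightarrow> y \<in> Y \<Longrightarrow> g x y = g' x y" for g g' X Y Z
  proof (rule PiE_ext)
    show "g \<in> X \<rightarrow>\<^sub>E (Y \<rightarrow>\<^sub>E Z)" "g' \<in> X \<rightarrow>\<^sub>E (Y \<rightarrow>\<^sub>E Z)" using that by (auto simp: bilinear_maps_def)
    fix x assume x: "x \<in> X"
    show "g x = g' x"
      by (rule PiE_ext[of _ Y "\<lambda>_. Z"]) (use that x in \<open>auto simp: bilinear_maps_def\<close>)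
  qed
  have sc: "x = y \<and> a = b" if "u = x + a" "u = y + b" "x \<in> A" "a \<in> V" "y \<in> A" "b \<in> V" for u x y a b
    using that sum_cancel by metis
  have "\<mu> a x = \<mu>' a x \<and> l x a = l' x a" if "x \<in> A" "a \<in> V" for x a
    using 1 2 that by (intro sc[of "f x a"]) (auto simp: has_blocks_def)
  moreover have "\<rho> a x = \<rho>' a x \<and> r x a = r' x a" if "x \<in> A" "a \<in> V" for x a
    using 1 2 that by (intro sc[of "f a x"]) (auto simp: has_blocks_def)
  moreover have "w a b = w' a b \<and> v a b = v' a b" if "a \<in> V" "b \<in> V" for a b
    using 1 2 that by (intro sc[of "f a b"]) (auto simp: has_blocks_def)
  ultimately show "l = l'" "r = r'" "\<rho> = \<rho>'" "\<mu> = \<mu>'" "w = w'" "v = v'"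
    using assms(3-) by (auto intro: ext)
qed

text \<open>
  Setting components of the arguments to \<open>0\<close> in the unified product formula isolates the blocks,
  since bilinear terms vanish there.
\<close>

lemma has_blocksI:
  assumes m: "bilinear_on scale A A A m"
    and lr: "{l, r} \<subseteq> bilinear_maps scale A V V" and \<rho>\<mu>: "{\<rho>, \<mu>} \<subseteq> bilinear_maps scale V A A"
    and w: "w \<in> bilinear_maps scale V V A" and v: "v \<in> bilinear_maps scale V V V"
    and f: "\<And>x a y b. x \<in> A \<Longrightarrow> a \<in> V \<Longrightarrow> y \<in> A \<Longrightarrow> b \<in> V \<Longrightarrow>
      f (x + a) (y + b) = (m x y + \<rho> a y + \<mu> b x + w a b) + (l x b + r y a + v a b)"
  shows "has_blocks f m l r \<rho> \<mu> w v"
proof -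
  have bil: "bilinear_on scale A V V l" "bilinear_on scale A V V r"
    "bilinear_on scale V A A \<rho>" "bilinear_on scale V A A \<mu>"
    "bilinear_on scale V V A w" "bilinear_on scale V V V v"
    using lr \<rho>\<mu> w v by (auto simp: bilinear_maps_def)
  have mem: "g x y \<in> Z" if "bilinear_on scale X Y Z g" "x \<in> X" "y \<in> Y" for g X Y Z x y
    using that by (auto simp: bilinear_on_def linear_on_def)
  note mem = m[THEN mem] bil[THEN mem]
  note zero = m[THEN bilinear_on_zero(1)] m[THEN bilinear_on_zero(2)]
    bil[THEN bilinear_on_zero(1)] bil[THEN bilinear_on_zero(2)]
  have "f x y = m x y" if "x \<in> A" "y \<in> A" for x y
    using f[of x 0 y 0] that by (simp add: zero)
  moreover have "f x a = \<mu> a x + l x a" if "x \<in> A" "a \<in> V" for x a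
    using f[of x 0 0 a] that by (simp add: zero)
  moreover have "f a x = \<rho> a x + r x a" if "x \<in> A" "a \<in> V" for x a
    using f[of 0 a x 0] that by (simp add: zero)
  moreover have "f a b = w a b + v a b" if "a \<in> V" "b \<in> V" for a b
    using f[of 0 a 0 b] that by (simp add: zero)
  ultimately show ?thesis
    by (simp add: has_blocks_def mem)
qed

section \<open>Linear maps stabilizing \<open>A\<close>\<close>

definition block_map :: "('e \<Rightarrow> 'e) \<Rightarrow> ('e \<Rightarrow> 'e) \<Rightarrow> 'e \<Rightarrow> 'e" where
  "block_map \<zeta> \<eta> u = proj_A u + \<zeta> (proj_V u) + \<eta> (proj_V u)"

context
  fixes \<zeta> \<eta> :: "'e \<Rightarrow> 'e"
  assumes \<zeta>: "linear_on scale V A \<zeta>" and \<eta>: "linear_on scale V V \<eta>"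
begin

lemma block_mem [simp]: "a \<in> V \<Longrightarrow> \<zeta> a \<in> A" "a \<in> V \<Longrightarrow> \<eta> a \<in> V"
  using \<zeta> \<eta> by (auto simp: linear_on_def)

lemma block_zero [simp]: "\<zeta> 0 = 0" "\<eta> 0 = 0"
  using \<zeta> \<eta> by (auto intro: linear_on_zero)

lemma linear_block_map: "Vector_Spaces.linear scale scale (block_map \<zeta> \<eta>)"
proof -
  have "block_map \<zeta> \<eta> (u + v) = block_map \<zeta> \<eta> u + block_map \<zeta> \<eta> v" for u v
    using \<zeta> \<eta> by (simp add: block_map_def proj_simps linear_on_def algebra_simps)
  moreover have "block_map \<zeta> \<eta> (scale c u) = scale c (block_map \<zeta> \<eta> u)" for c u
    using \<zeta> \<eta> by (simp add: block_map_def proj_simps linear_on_def algebra_simps)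
  ultimately show ?thesis
    by (simp add: linear_iff_module_hom module_hom_iff module_axioms)
qed

lemma block_map_A: "x \<in> A \<Longrightarrow> block_map \<zeta> \<eta> x = x"
  by (simp add: block_map_def)

lemma block_map_V: "a \<in> V \<Longrightarrow> block_map \<zeta> \<eta> a = \<zeta> a + \<eta> a"
  by (simp add: block_map_def)

lemma decomp_block_map:
  "decomp A V (block_map \<zeta> \<eta> u) = (proj_A u + \<zeta> (proj_V u), \<eta> (proj_V u))"
  by (simp add: block_map_def)

lemma bij_block_map_iff: "bij (block_map \<zeta> \<eta>) \<longleftrightarrow> bij_betw \<eta> V V"
proof
  assume bij: "bij (block_map \<zeta> \<eta>)"
  show "bij_betw \<eta> V V"
    unfolding bij_betw_def
  proof
    show "inj_on \<eta> V"
    proof (rule inj_onI)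
      fix a b assume a: "a \<in> V" and b: "b \<in> V" and eq: "\<eta> a = \<eta> b"
      \<comment> \<open>The differing \<open>A\<close>-parts of the images of \<open>a\<close> and \<open>b\<close> are compensated inside \<open>A\<close>, where the
        map is the identity.\<close>
      have "block_map \<zeta> \<eta> (\<zeta> b + a) = block_map \<zeta> \<eta> (\<zeta> a + b)"
        using a b eq by (simp add: block_map_def add.commute[of "\<zeta> b" "\<zeta> a"])
      then have "\<zeta> b + a = \<zeta> a + b" using bij by (auto dest: bij_is_inj injD)
      then show "a = b" using a b by (simp add: sum_cancel)
    qed
    show "\<eta> ` V = V"
    proof (intro equalityI subsetI)
      fix b assume b: "b \<in> V"
      obtain u where "block_map \<zeta> \<eta> u = b" using bij by (metis bij_pointE)
      then have "\<eta> (proj_V u) = b" using decomp_block_map[of u] b by simp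
      then show "b \<in> \<eta> ` V" using proj_mem(2) by blast
    qed auto
  qed
next
  assume bij: "bij_betw \<eta> V V"
  show "bij (block_map \<zeta> \<eta>)"
    unfolding bij_def
  proof
    show "inj (block_map \<zeta> \<eta>)"
    proof (rule injI)
      fix u v assume "block_map \<zeta> \<eta> u = block_map \<zeta> \<eta> v"
      then have eq: "proj_A u + \<zeta> (proj_V u) = proj_A v + \<zeta> (proj_V v)"
        "\<eta> (proj_V u) = \<eta> (proj_V v)"
        using decomp_block_map[of u] decomp_block_map[of v] by auto
      from eq(2) have "proj_V u = proj_V v"
        using bij by (auto simp: bij_betw_def inj_on_def)
      with eq(1) show "u = v" using eq_iff_proj[of u v] by simp
    qed
    show "surj (block_map \<zeta> \<eta>)"
      unfolding surj_def
    proof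
      fix u
      obtain a where a: "a \<in> V" "\<eta> a = proj_V u"
        using bij proj_mem(2)[of u] by (metis bij_betw_def imageE)
      have "proj_A u - \<zeta> a \<in> A" using a(1) A by (auto intro: subspace_diff)
      then have "block_map \<zeta> \<eta> ((proj_A u - \<zeta> a) + a) = u"
        using a by (simp add: block_map_def del: diff_add_cancel)
      then show "\<exists>v. u = block_map \<zeta> \<eta> v" by metis
    qed
  qed
qed

lemma co_stabilizes_iff:
  "proj_along A V \<circ> block_map \<zeta> \<eta> = proj_along A V \<longleftrightarrow> (\<forall>a\<in>V. \<eta> a = a)"
proof
  assume "proj_along A V \<circ> block_map \<zeta> \<eta> = proj_along A V"
  then have "proj_V (block_map \<zeta> \<eta> a) = proj_V a" for a
    by (auto simp: proj_along_def fun_eq_iff)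
  then show "\<forall>a\<in>V. \<eta> a = a"
    by (metis decomp_V decomp_block_map snd_conv)
qed (auto simp: proj_along_def fun_eq_iff decomp_block_map)

text \<open>
  By biadditivity, multiplicativity has to be checked on pairs from \<open>A \<union> V\<close> only. It holds on
  \<open>A \<times> A\<close> because both operations restrict to \<open>m\<close> there; on each of the three other blocks, the
  \<open>V\<close>-components give a condition on \<open>\<eta>\<close> and the \<open>A\<close>-components a condition on \<open>\<zeta>\<close>.
\<close>

lemma block_map_multiplicative_iff:
  assumes f: "biadditive f" "has_blocks f m l r \<rho> \<mu> w v"
    and f': "biadditive f'" "has_blocks f' m l' r' \<rho>' \<mu>' w' v'"
  shows "(\<forall>u v. block_map \<zeta> \<eta> (f u v) = f' (block_map \<zeta> \<eta> u) (block_map \<zeta> \<eta> v)) \<longleftrightarrow>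
     (\<forall>x\<in>A. \<forall>a\<in>V.
        \<eta> (l x a) = l' x (\<eta> a) \<and> \<eta> (r x a) = r' x (\<eta> a) \<and>
        \<zeta> (l x a) = m x (\<zeta> a) - \<mu> a x + \<mu>' (\<eta> a) x \<and>
        \<zeta> (r x a) = m (\<zeta> a) x - \<rho> a x + \<rho>' (\<eta> a) x) \<and>
     (\<forall>a\<in>V. \<forall>b\<in>V.
        \<eta> (v a b) = v' (\<eta> a) (\<eta> b) + l' (\<zeta> a) (\<eta> b) + r' (\<zeta> b) (\<eta> a) \<and>
        \<zeta> (v a b) + w a b =
          m (\<zeta> a) (\<zeta> b) + \<rho>' (\<eta> a) (\<zeta> b) + \<mu>' (\<eta> b) (\<zeta> a) + w' (\<eta> a) (\<eta> b))"
  (is "(\<forall>u v. ?\<phi> (f u v) = f' (?\<phi> u) (?\<phi> v)) \<longleftrightarrow> ?cond")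
proof -
  have add: "?\<phi> (u + v) = ?\<phi> u + ?\<phi> v" for u v
    using linear_block_map by (simp add: linear_iff_module_hom module_hom_iff)
  have f_add: "f (u + u') v = f u v + f u' v" "f v (u + u') = f v u + f v u'" for u u' v
    using f(1) by (auto simp: biadditive_def)
  have f'_add: "f' (u + u') v = f' u v + f' u' v" "f' v (u + u') = f' v u + f' v u'" for u u' v
    using f'(1) by (auto simp: biadditive_def)
  let ?M = "\<lambda>u v. ?\<phi> (f u v) = f' (?\<phi> u) (?\<phi> v)"
  have AA: "?M x y" if "x \<in> A" "y \<in> A" for x y
    using f(2) f'(2) that by (simp add: has_blocks_def block_map_A)
  have blocks: "(\<forall>u v. ?M u v) \<longleftrightarrow>
    (\<forall>x\<in>A. \<forall>a\<in>V. ?M x a \<and> ?M a x) \<and> (\<forall>a\<in>V. \<forall>b\<in>V. ?M a b)" (is "_ \<longleftrightarrow> ?B")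
  proof
    assume B: ?B
    show "\<forall>u v. ?M u v"
    proof (intro allI)
      fix u v
      obtain x a y b where "x \<in> A" "a \<in> V" "u = x + a" "y \<in> A" "b \<in> V" "v = y + b"
        by (metis decompE)
      then show "?M u v" using B AA by (simp add: add f_add f'_add)
    qed
  qed blast
  have AV: "?M x a \<longleftrightarrow> \<eta> (l x a) = l' x (\<eta> a) \<and> \<zeta> (l x a) = m x (\<zeta> a) - \<mu> a x + \<mu>' (\<eta> a) x"
    if "x \<in> A" "a \<in> V" for x a
  proof -
    have "?\<phi> (f x a) = (\<mu> a x + \<zeta> (l x a)) + \<eta> (l x a)"
      using f(2) that by (simp add: has_blocks_def add block_map_A block_map_V algebra_simps)
    moreover have "f' (?\<phi> x) (?\<phi> a) = (m x (\<zeta> a) + \<mu>' (\<eta> a) x) + l' x (\<eta> a)"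
      using f'(2) that by (simp add: has_blocks_def f'_add block_map_A block_map_V algebra_simps)
    ultimately have "?M x a \<longleftrightarrow> \<mu> a x + \<zeta> (l x a) = m x (\<zeta> a) + \<mu>' (\<eta> a) x \<and> \<eta> (l x a) = l' x (\<eta> a)"
      using f(2) f'(2) that by (simp add: has_blocks_def sum_cancel del: add.assoc)
    then show ?thesis by (auto simp: algebra_simps)
  qed
  have VA: "?M a x \<longleftrightarrow> \<eta> (r x a) = r' x (\<eta> a) \<and> \<zeta> (r x a) = m (\<zeta> a) x - \<rho> a x + \<rho>' (\<eta> a) x"
    if "x \<in> A" "a \<in> V" for x a
  proof -
    have "?\<phi> (f a x) = (\<rho> a x + \<zeta> (r x a)) + \<eta> (r x a)"
      using f(2) that by (simp add: has_blocks_def add block_map_A block_map_V algebra_simps)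
    moreover have "f' (?\<phi> a) (?\<phi> x) = (m (\<zeta> a) x + \<rho>' (\<eta> a) x) + r' x (\<eta> a)"
      using f'(2) that by (simp add: has_blocks_def f'_add block_map_A block_map_V algebra_simps)
    ultimately have "?M a x \<longleftrightarrow> \<rho> a x + \<zeta> (r x a) = m (\<zeta> a) x + \<rho>' (\<eta> a) x \<and> \<eta> (r x a) = r' x (\<eta> a)"
      using f(2) f'(2) that by (simp add: has_blocks_def sum_cancel del: add.assoc)
    then show ?thesis by (auto simp: algebra_simps)
  qed
  have VV: "?M a b \<longleftrightarrow>
        \<eta> (v a b) = v' (\<eta> a) (\<eta> b) + l' (\<zeta> a) (\<eta> b) + r' (\<zeta> b) (\<eta> a) \<and>
        \<zeta> (v a b) + w a b =
          m (\<zeta> a) (\<zeta> b) + \<rho>' (\<eta> a) (\<zeta> b) + \<mu>' (\<eta> b) (\<zeta> a) + w' (\<eta> a) (\<eta> b)"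
    if "a \<in> V" "b \<in> V" for a b
  proof -
    have "?\<phi> (f a b) = (\<zeta> (v a b) + w a b) + \<eta> (v a b)"
      using f(2) that by (simp add: has_blocks_def add block_map_A block_map_V algebra_simps)
    moreover have "f' (?\<phi> a) (?\<phi> b) =
      (m (\<zeta> a) (\<zeta> b) + \<rho>' (\<eta> a) (\<zeta> b) + \<mu>' (\<eta> b) (\<zeta> a) + w' (\<eta> a) (\<eta> b)) +
      (v' (\<eta> a) (\<eta> b) + l' (\<zeta> a) (\<eta> b) + r' (\<zeta> b) (\<eta> a))"
      using f'(2) that by (simp add: has_blocks_def f'_add block_map_V algebra_simps)
    ultimately show ?thesis
      using f(2) f'(2) that by (simp add: has_blocks_def sum_cancel conj_commute del: add.assoc)
  qed
  show ?thesis
    unfolding blocks using AV VA VV by (simp add: conj_ac cong: ball_cong)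
qed

end

lemma ex_block_map:
  assumes lin: "Vector_Spaces.linear scale scale \<phi>" and fix_A: "\<forall>x\<in>A. \<phi> x = x"
  obtains \<zeta> \<eta> where "linear_on scale V A \<zeta>" "linear_on scale V V \<eta>" "\<phi> = block_map \<zeta> \<eta>"
proof
  have add: "\<phi> (u + v) = \<phi> u + \<phi> v" and scl: "\<phi> (scale c u) = scale c (\<phi> u)" for u v c
    using lin by (simp_all add: linear_iff_module_hom module_hom_iff)
  show "linear_on scale V A (\<lambda>a. proj_A (\<phi> a))" "linear_on scale V V (\<lambda>a. proj_V (\<phi> a))"
    by (auto simp: linear_on_def add scl proj_simps)
  show "\<phi> = block_map (\<lambda>a. proj_A (\<phi> a)) (\<lambda>a. proj_V (\<phi> a))"
  proof
    fix u
    have "\<phi> u = \<phi> (proj_A u) + \<phi> (proj_V u)" by (simp flip: add)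
    then show "\<phi> u = block_map (\<lambda>a. proj_A (\<phi> a)) (\<lambda>a. proj_V (\<phi> a)) u"
      using fix_A by (simp add: block_map_def add.assoc)
  qed
qed

end

section \<open>Extending structures as algebra structures on \<open>E\<close>\<close>

locale anti_dendriform_extension_problem = complementary_subspaces scale A V +
  A: anti_dendriform_algebra scale A succ prec
  for scale :: "'k::field \<Rightarrow> 'e::ab_group_add \<Rightarrow> 'e" and A V
    and succ :: "'e \<Rightarrow> 'e \<Rightarrow> 'e" (infixl "\<succ>" 70)
    and prec :: "'e \<Rightarrow> 'e \<Rightarrow> 'e" (infixl "\<prec>" 70)
begin

abbreviation "structures \<equiv> extending_structures scale A V (\<succ>) (\<prec>)"
abbreviation "extensions \<equiv> extension_structures scale A (\<succ>) (\<prec>)"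
abbreviation "product \<equiv> unified_product A V (\<succ>) (\<prec>)"

definition product_blocks :: "'e ext_datum \<Rightarrow> ('e \<Rightarrow> 'e \<Rightarrow> 'e) \<times> ('e \<Rightarrow> 'e \<Rightarrow> 'e) \<Rightarrow> bool" where
  "product_blocks \<Omega> P \<longleftrightarrow>
     has_blocks (fst P) (\<succ>) (l_succ \<Omega>) (r_succ \<Omega>) (rho_succ \<Omega>) (mu_succ \<Omega>) (varpi1 \<Omega>) (succ_V \<Omega>) \<and>
     has_blocks (snd P) (\<prec>) (l_prec \<Omega>) (r_prec \<Omega>) (rho_prec \<Omega>) (mu_prec \<Omega>) (varpi2 \<Omega>) (prec_V \<Omega>)"

lemma closed: "x \<in> A \<Longrightarrow> y \<in> A \<Longrightarrow> x \<succ> y \<in> A" "x \<in> A \<Longrightarrow> y \<in> A \<Longrightarrow> x \<prec> y \<in> A"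
  using A.bilinear_succ A.bilinear_prec by (auto simp: bilinear_on_def linear_on_def)

lemma product_blocks_product:
  assumes "extending_datum scale A V \<Omega>"
  shows "product_blocks \<Omega> (product \<Omega>)"
  unfolding product_blocks_def
  using assms
  by (intro conjI has_blocksI[OF A.bilinear_succ] has_blocksI[OF A.bilinear_prec])
    (auto simp: extending_datum_def unified_product_def unified_succ_def unified_prec_def)

text \<open>
  An operation on \<open>E\<close> with blocks \<open>\<Omega>\<close> corresponds to the unified product of \<open>\<Omega>\<close> under \<open>decomp\<close>. This
  is the multiplicativity needed for transporting the algebra structure from \<open>E\<close> to \<open>A \<times> V\<close>.
\<close>

lemma unified_eq_decomp:
  assumes P: "biadditive (fst P)" "biadditive (snd P)" "product_blocks \<Omega> P"
    and "u \<in> A \<times> V" "v \<in> A \<times> V"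
  shows "unified_succ (\<succ>) \<Omega> u v = decomp A V (fst P (fst u + snd u) (fst v + snd v))"
    and "unified_prec (\<prec>) \<Omega> u v = decomp A V (snd P (fst u + snd u) (fst v + snd v))"
  using assms
  by (auto simp: unified_succ_def unified_prec_def product_blocks_def decomp_op_if_has_blocks)

lemma product_eq_if_product_blocks:
  assumes "biadditive (fst P)" "biadditive (snd P)" "product_blocks \<Omega> P"
  shows "product \<Omega> = P"
proof -
  have d: "decomp A V u \<in> A \<times> V" for u by (simp add: mem_Times_iff)
  show ?thesis
    unfolding unified_product_def unified_eq_decomp[OF assms d d]
    by (simp add: case_prod_beta)
qed

lemma product_in_extensions:
  assumes "\<Omega> \<in> structures"
  shows "product \<Omega> \<in> extensions"
proof -
  have datum: "extending_datum scale A V \<Omega>"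
    and alg: "anti_dendriform_algebra (module_prod.scale scale scale) (A \<times> V)
            (unified_succ (\<succ>) \<Omega>) (unified_prec (\<prec>) \<Omega>)"
    using assms by (auto simp: extending_structures_def)
  interpret M: module_prod scale scale ..
  have "anti_dendriform_algebra scale UNIV (fst (product \<Omega>)) (snd (product \<Omega>))"
    by (rule anti_dendriform_algebra_transport[OF alg vector_space_axioms subspace_UNIV bij_betw_sum])
      (auto simp: unified_product_def M.scale_def algebra_simps)
  then show ?thesis
    using product_blocks_product[OF datum]
    by (auto simp: extension_structures_def case_prod_beta product_blocks_def has_blocks_def)
qed

lemma biadditive_extension:
  assumes "P \<in> extensions"
  shows "biadditive (fst P)" "biadditive (snd P)"
proof -
  interpret P: anti_dendriform_algebra scale UNIV "fst P" "snd P"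
    using assms by (auto simp: extension_structures_def)
  show "biadditive (fst P)" "biadditive (snd P)"
    using P.bilinear_succ P.bilinear_prec by (auto intro: biadditive_if_bilinear_on)
qed

text \<open>The extending structure is the one formed by the blocks of the two operations.\<close>

lemma ex_structure:
  assumes "P \<in> extensions"
  shows "\<exists>\<Omega>\<in>structures. product \<Omega> = P"
proof -
  interpret P: anti_dendriform_algebra scale UNIV "fst P" "snd P"
    using assms by (auto simp: extension_structures_def)
  define \<Omega> where "\<Omega> = \<lparr>
    l_succ = (\<lambda>x\<in>A. \<lambda>a\<in>V. proj_V (fst P x a)), r_succ = (\<lambda>x\<in>A. \<lambda>a\<in>V. proj_V (fst P a x)),
    l_prec = (\<lambda>x\<in>A. \<lambda>a\<in>V. proj_V (snd P x a)), r_prec = (\<lambda>x\<in>A. \<lambda>a\<in>V. proj_V (snd P a x)),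
    rho_succ = (\<lambda>a\<in>V. \<lambda>x\<in>A. proj_A (fst P a x)), mu_succ = (\<lambda>a\<in>V. \<lambda>x\<in>A. proj_A (fst P x a)),
    rho_prec = (\<lambda>a\<in>V. \<lambda>x\<in>A. proj_A (snd P a x)), mu_prec = (\<lambda>a\<in>V. \<lambda>x\<in>A. proj_A (snd P x a)),
    varpi1 = (\<lambda>a\<in>V. \<lambda>b\<in>V. proj_A (fst P a b)), varpi2 = (\<lambda>a\<in>V. \<lambda>b\<in>V. proj_A (snd P a b)),
    succ_V = (\<lambda>a\<in>V. \<lambda>b\<in>V. proj_V (fst P a b)), prec_V = (\<lambda>a\<in>V. \<lambda>b\<in>V. proj_V (snd P a b))\<rparr>"
  have datum: "extending_datum scale A V \<Omega>"
    unfolding extending_datum_def \<Omega>_def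
    using bilinear_read_off[OF P.bilinear_succ] bilinear_read_off[OF P.bilinear_prec] by simp
  have restr: "fst P x y = x \<succ> y \<and> x \<succ> y \<in> A" "snd P x y = x \<prec> y \<and> x \<prec> y \<in> A"
    if "x \<in> A" "y \<in> A" for x y
    using assms that closed by (auto simp: extension_structures_def)
  have blocks: "product_blocks \<Omega> P"
    using has_blocks_read_off[of "fst P" "(\<succ>)", OF restr(1)]
      has_blocks_read_off[of "snd P" "(\<prec>)", OF restr(2)]
    by (simp add: product_blocks_def \<Omega>_def)
  note bi = biadditive_extension[OF assms]
  interpret M: module_prod scale scale ..
  have d: "decomp A V u \<in> A \<times> V" for u by (simp add: mem_Times_iff)
  have "anti_dendriform_algebra (module_prod.scale scale scale) (A \<times> V)
            (unified_succ (\<succ>) \<Omega>) (unified_prec (\<prec>) \<Omega>)"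
    by (rule anti_dendriform_algebra_transport[OF P.anti_dendriform_algebra_axioms
          vector_space_prod subspace_prod bij_decomp])
      (simp_all add: decomp_add decomp_scale M.scale_def unified_eq_decomp[OF bi blocks d d])
  then have "\<Omega> \<in> structures" using datum by (simp add: extending_structures_def)
  then show ?thesis using product_eq_if_product_blocks[OF bi blocks] by blast
qed

lemma inj_product: "inj_on product structures"
proof (rule inj_onI)
  fix \<Omega> \<Omega>' assume "\<Omega> \<in> structures" "\<Omega>' \<in> structures" and eq: "product \<Omega> = product \<Omega>'"
  then have d: "extending_datum scale A V \<Omega>" "extending_datum scale A V \<Omega>'"
    by (auto simp: extending_structures_def)
  have "product_blocks \<Omega> (product \<Omega>)" "product_blocks \<Omega>' (product \<Omega>)"
    using product_blocks_product[OF d(1)] product_blocks_product[OF d(2)] eq by simp_all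
  note blocks = this[unfolded product_blocks_def]
  note succ = has_blocks_unique[OF conjunct1[OF blocks(1)] conjunct1[OF blocks(2)]]
  note prec = has_blocks_unique[OF conjunct2[OF blocks(1)] conjunct2[OF blocks(2)]]
  show "\<Omega> = \<Omega>'"
    by (intro ext_datum.equality succ prec) (use d in \<open>simp_all add: extending_datum_def\<close>)
qed

lemma bij_product: "bij_betw product structures extensions"
  unfolding bij_betw_def using inj_product product_in_extensions ex_structure by blast

section \<open>Equivalences as isomorphisms stabilizing \<open>A\<close>\<close>

lemma datum_morphism_iff_algebra_iso:
  assumes \<Omega>: "\<Omega> \<in> structures" "\<Omega>' \<in> structures"
    and \<zeta>: "linear_on scale V A \<zeta>" and \<eta>: "linear_on scale V V \<eta>"
  shows "datum_morphism scale A V (\<succ>) (\<prec>) \<Omega> \<Omega>' \<zeta> \<eta> \<longleftrightarrow>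
    algebra_iso scale (product \<Omega>) (product \<Omega>') (block_map \<zeta> \<eta>)"
proof -
  have blocks: "product_blocks \<Omega> (product \<Omega>)" "product_blocks \<Omega>' (product \<Omega>')"
    using \<Omega> product_blocks_product by (auto simp: extending_structures_def)
  note bi = biadditive_extension[OF product_in_extensions[OF \<Omega>(1)]]
    biadditive_extension[OF product_in_extensions[OF \<Omega>(2)]]
  note succ = block_map_multiplicative_iff[OF \<zeta> \<eta> bi(1) conjunct1[OF blocks(1)[unfolded product_blocks_def]]
      bi(3) conjunct1[OF blocks(2)[unfolded product_blocks_def]]]
  note prec = block_map_multiplicative_iff[OF \<zeta> \<eta> bi(2) conjunct2[OF blocks(1)[unfolded product_blocks_def]]
      bi(4) conjunct2[OF blocks(2)[unfolded product_blocks_def]]]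
  show ?thesis
    unfolding algebra_iso_def datum_morphism_def succ prec bij_block_map_iff[OF \<zeta> \<eta>]
    using linear_block_map[OF \<zeta> \<eta>] \<zeta> \<eta> by blast
qed

lemma equiv_iff:
  assumes \<Omega>: "\<Omega> \<in> structures" "\<Omega>' \<in> structures"
  shows "(\<Omega>, \<Omega>') \<in> datum_equiv scale A V (\<succ>) (\<prec>) \<longleftrightarrow>
      (product \<Omega>, product \<Omega>') \<in> extension_equiv scale A (\<succ>) (\<prec>)" (is ?equiv)
    and "(\<Omega>, \<Omega>') \<in> datum_cohom scale A V (\<succ>) (\<prec>) \<longleftrightarrow>
      (product \<Omega>, product \<Omega>') \<in> extension_cohom scale A V (\<succ>) (\<prec>)" (is ?cohom)
proof -
  let ?mor = "datum_morphism scale A V (\<succ>) (\<prec>) \<Omega> \<Omega>'"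
  let ?iso = "algebra_iso scale (product \<Omega>) (product \<Omega>')"
  let ?costab = "\<lambda>\<phi>. proj_along A V \<circ> \<phi> = proj_along A V"
  have to_iso: "?iso (block_map \<zeta> \<eta>)" "\<forall>x\<in>A. block_map \<zeta> \<eta> x = x"
      "?costab (block_map \<zeta> \<eta>) \<longleftrightarrow> (\<forall>a\<in>V. \<eta> a = a)"
    if mor: "?mor \<zeta> \<eta>" for \<zeta> \<eta>
  proof -
    have lin: "linear_on scale V A \<zeta>" "linear_on scale V V \<eta>"
      using mor by (simp_all add: datum_morphism_def)
    show "?iso (block_map \<zeta> \<eta>)"
      using mor by (simp only: datum_morphism_iff_algebra_iso[OF \<Omega> lin])
    show "\<forall>x\<in>A. block_map \<zeta> \<eta> x = x"
      using block_map_A[OF lin] by blast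
    show "?costab (block_map \<zeta> \<eta>) \<longleftrightarrow> (\<forall>a\<in>V. \<eta> a = a)"
      by (rule co_stabilizes_iff[OF lin])
  qed
  have from_iso: "\<exists>\<zeta> \<eta>. ?mor \<zeta> \<eta> \<and> \<phi> = block_map \<zeta> \<eta>"
    if iso: "?iso \<phi>" and fix_A: "\<forall>x\<in>A. \<phi> x = x" for \<phi>
  proof -
    have "Vector_Spaces.linear scale scale \<phi>" using iso by (simp add: algebra_iso_def)
    from this fix_A obtain \<zeta> \<eta> where lin: "linear_on scale V A \<zeta>" "linear_on scale V V \<eta>"
      and \<phi>: "\<phi> = block_map \<zeta> \<eta>"
      by (rule ex_block_map)
    have "?mor \<zeta> \<eta>"
      using iso unfolding \<phi> by (simp only: datum_morphism_iff_algebra_iso[OF \<Omega> lin])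
    with \<phi> show ?thesis by blast
  qed
  have "(\<exists>\<zeta> \<eta>. ?mor \<zeta> \<eta>) \<longleftrightarrow> (\<exists>\<phi>. ?iso \<phi> \<and> (\<forall>x\<in>A. \<phi> x = x))"
  proof (intro iffI; elim exE conjE)
    show "\<exists>\<phi>. ?iso \<phi> \<and> (\<forall>x\<in>A. \<phi> x = x)" if "?mor \<zeta> \<eta>" for \<zeta> \<eta>
      using to_iso(1,2)[OF that] by (intro exI conjI)
    show "\<exists>\<zeta> \<eta>. ?mor \<zeta> \<eta>" if "?iso \<phi>" "\<forall>x\<in>A. \<phi> x = x" for \<phi>
      using from_iso[OF that] by (elim exE conjE) (intro exI)
  qed
  then show ?equiv
    by (simp add: datum_equiv_def extension_equiv_def \<Omega> product_in_extensions)
  have "(\<exists>\<zeta> \<eta>. ?mor \<zeta> \<eta> \<and> (\<forall>a\<in>V. \<eta> a = a)) \<longleftrightarrow>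
      (\<exists>\<phi>. ?iso \<phi> \<and> (\<forall>x\<in>A. \<phi> x = x) \<and> ?costab \<phi>)"
  proof (intro iffI; elim exE conjE)
    show "\<exists>\<phi>. ?iso \<phi> \<and> (\<forall>x\<in>A. \<phi> x = x) \<and> ?costab \<phi>"
      if "?mor \<zeta> \<eta>" "\<forall>a\<in>V. \<eta> a = a" for \<zeta> \<eta>
      using to_iso(1,2)[OF that(1)] iffD2[OF to_iso(3)[OF that(1)] that(2)] by (intro exI conjI)
    show "\<exists>\<zeta> \<eta>. ?mor \<zeta> \<eta> \<and> (\<forall>a\<in>V. \<eta> a = a)"
      if \<phi>: "?iso \<phi>" "\<forall>x\<in>A. \<phi> x = x" "?costab \<phi>" for \<phi>
    proof -
      obtain \<zeta> \<eta> where mor: "?mor \<zeta> \<eta>" and eq: "\<phi> = block_map \<zeta> \<eta>"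
        using from_iso[OF \<phi>(1,2)] by (elim exE conjE)
      show ?thesis
        using mor iffD1[OF to_iso(3)[OF mor] \<phi>(3)[unfolded eq]] by (intro exI conjI)
    qed
  qed
  then show ?cohom
    by (simp add: datum_cohom_def extension_cohom_def \<Omega> product_in_extensions)
qed

end

theorem theorem3p7:
  fixes scale :: "'k::field \<Rightarrow> 'e::ab_group_add \<Rightarrow> 'e"
    and Basis A V :: "'e set"
    and succ prec :: "'e \<Rightarrow> 'e \<Rightarrow> 'e"
  assumes "finite_dimensional_vector_space scale Basis"
    and "module.subspace scale A"
    and "module.subspace scale V"
    and "A \<inter> V = {0}"
    and "{x + a | x a. x \<in> A \<and> a \<in> V} = UNIV"
    and "anti_dendriform_algebra scale A succ prec"
  shows "(\<exists>\<Phi>.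
            (\<forall>\<Omega> \<in> extending_structures scale A V succ prec.
               \<Phi> (datum_equiv scale A V succ prec `` {\<Omega>}) =
               extension_equiv scale A succ prec `` {unified_product A V succ prec \<Omega>}) \<and>
            bij_betw \<Phi> (H2p scale A V succ prec) (EXT scale A succ prec)) \<and>
         (\<exists>\<Psi>.
            (\<forall>\<Omega> \<in> extending_structures scale A V succ prec.
               \<Psi> (datum_cohom scale A V succ prec `` {\<Omega>}) =
               extension_cohom scale A V succ prec `` {unified_product A V succ prec \<Omega>}) \<and>
            bij_betw \<Psi> (H2 scale A V succ prec) (EXT' scale A V succ prec))"
proof -
  interpret A: anti_dendriform_algebra scale A succ prec by (rule assms(6))
  interpret anti_dendriform_extension_problem scale A V succ prec
    by unfold_locales (use assms(2-5) in auto)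
  have "(\<forall>\<Omega>\<in>structures. (`) product (datum_equiv scale A V succ prec `` {\<Omega>}) =
        extension_equiv scale A succ prec `` {product \<Omega>}) \<and>
      bij_betw ((`) product) (H2p scale A V succ prec) (EXT scale A succ prec)"
    unfolding H2p_def EXT_def
    by (rule image_bij_betw_quotients[OF bij_product _ _ equiv_iff(1)])
      (auto simp: datum_equiv_def extension_equiv_def)
  moreover have "(\<forall>\<Omega>\<in>structures. (`) product (datum_cohom scale A V succ prec `` {\<Omega>}) =
        extension_cohom scale A V succ prec `` {product \<Omega>}) \<and>
      bij_betw ((`) product) (H2 scale A V succ prec) (EXT' scale A V succ prec)"
    unfolding H2_def EXT'_def
    by (rule image_bij_betw_quotients[OF bij_product _ _ equiv_iff(2)])
      (auto simp: datum_cohom_def extension_cohom_def)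
  ultimately show ?thesis by blast
qed

end
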